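(* Let $n\ge 1$ be an integer and let $R_n(f_k(x))$ be the $n\times n$ matrix (over the field of rational functions $\mathbb{Q}(x)$) whose $(i,j)$-entry is $1/f_{i+j-1}(x)$ for $1\le i,j\le n$, where $f_k(x)$ is the $k$-th Fibonacci polynomial. Let $e(n,i,j)=n(i+j+1)+\binom{i}{2}+\binom{j}{2}+1$, and let $V(n)$ be the $n\times n$ matrix whose $(i,j)$-entry ($1\le i,j\le n$) is $$V_{ij}(n)=(-1)^{e(n,i,j)}\,f_{i+j-1}(x)\left(\!\binom{n+i-1}{n-j}\!\right)_x\left(\!\binom{n+j-1}{n-i}\!\right)_x\left(\!\binom{i+j-2}{i-1}\!\right)_x^2,$$ where $\left(\!\binom{a}{b}\!\right)_x$ denotes the $x$-Fibonomial coefficient. Then $V(n)$ is the inverse of $R_n(f_k(x))$, and all entries of $V(n)$ are polynomials in $x$ with integer coefficients.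
   Context: The Fibonacci polynomials are defined by $f_0(x)=0$, $f_1(x)=1$, and $f_k(x)=x f_{k-1}(x)+f_{k-2}(x)$ for $k\ge 2$. For nonnegative integers $a,b$, the $x$-Fibonomial coefficient is $\left(\!\binom{a}{b}\!\right)_x=\prod_{t=1}^{b}\frac{f_{a-t+1}(x)}{f_t(x)}\in\mathbb{Q}(x)$ (equal to $1$ when $b=0$). *)

theory Defs
  imports
    "HOL-Computational_Algebra.Polynomial_Factorial"
    "Jordan_Normal_Form.Matrix"
begin

fun fib_poly :: "nat \<Rightarrow> rat poly" where
  "fib_poly 0 = 0"
| "fib_poly (Suc 0) = 1"
| "fib_poly (Suc (Suc k)) = [:0, 1:] * fib_poly (Suc k) + fib_poly k"

text \<open>The field of rational functions over the rationals is \<^typ>\<open>rat poly fract\<close>.\<close>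

definition fib_rat :: "nat \<Rightarrow> rat poly fract" where
  "fib_rat k = to_fract (fib_poly k)"

text \<open>
  The index \<open>a - t + 1\<close> is written \<open>a + 1 - t\<close>, because with truncated subtraction on
  the naturals only the latter is \<open>0\<close> at \<open>t = a + 1\<close>. So for \<open>b > a\<close> the coefficient
  vanishes.
\<close>

definition fibonomial :: "nat \<Rightarrow> nat \<Rightarrow> rat poly fract" where
  "fibonomial a b = (\<Prod>t = 1..b. fib_rat (a + 1 - t) / fib_rat t)"

text \<open>
  Matrix indices in \<^typ>\<open>'a mat\<close> start at \<open>0\<close>. Entry formulas are stated for
  indices starting at \<open>1\<close> and are shifted when the matrix is formed.
\<close>

definition recip_hankel_mat :: "nat \<Rightarrow> (nat \<Rightarrow> 'a) \<Rightarrow> 'a :: field mat" where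
  "recip_hankel_mat n a = mat n n (\<lambda>(i, j). 1 / a ((i + 1) + (j + 1) - 1))"

definition sign_exp :: "nat \<Rightarrow> nat \<Rightarrow> nat \<Rightarrow> nat" where
  "sign_exp n i j = n * (i + j + 1) + (i choose 2) + (j choose 2) + 1"

definition V_entry :: "nat \<Rightarrow> nat \<Rightarrow> nat \<Rightarrow> rat poly fract" where
  "V_entry n i j =
     (- 1) ^ sign_exp n i j * fib_rat (i + j - 1)
       * fibonomial (n + i - 1) (n - j) * fibonomial (n + j - 1) (n - i)
       * (fibonomial (i + j - 2) (i - 1))\<^sup>2"

definition V_mat :: "nat \<Rightarrow> rat poly fract mat" where
  "V_mat n = mat n n (\<lambda>(i, j). V_entry n (i + 1) (j + 1))"

end

theory Submission
  imports Defs "Jordan_Normal_Form.Determinant"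
begin

text \<open>
  The ratios \<open>z a = f a / f (a + 1)\<close> satisfy
  \<open>f (a + 1) * f (b + 1) * (z a - z b) = (- 1) ^ b * f (a - b)\<close> for \<open>b \<le> a\<close> (d'Ocagne).
  Hence, with \<open>x i = z (n - i)\<close> and \<open>y k = z (n + k - 1)\<close>, the matrix is a Cauchy matrix
  \<open>1 / (y k - x i)\<close> up to row and column factors. The nodes \<open>z 0, \<dots>, z (2 * n - 1)\<close> are
  distinct, so the Cauchy matrix is inverted by Lagrange interpolation, and the products in its inverse
  collapse to Fibonomial coefficients. These are integer polynomials by a Pascal-type recurrence.
\<close>

section \<open>Lagrange interpolation and inverses of Cauchy matrices\<close>

text \<open>Both sides are polynomials in \<open>t\<close> of degree below \<open>card I\<close>,
  and they agree at the \<open>card I\<close> distinct nodes.\<close>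

lemma lagrange_interpolation:
  fixes y :: "'i \<Rightarrow> 'a :: field"
  assumes "finite I" "inj_on y I" "degree p < card I"
  shows "poly p t = (\<Sum>k\<in>I. poly p (y k) * (\<Prod>m\<in>I - {k}. (t - y m) / (y k - y m)))"
proof -
  define q where "q = (\<Sum>k\<in>I. Polynomial.smult (poly p (y k)) (\<Prod>m\<in>I - {k}. Polynomial.smult (1 / (y k - y m)) [:- y m, 1:]))"
  have poly_q: "poly q s = (\<Sum>k\<in>I. poly p (y k) * (\<Prod>m\<in>I - {k}. (s - y m) / (y k - y m)))" for s
    by (simp add: q_def poly_sum poly_prod diff_divide_distrib)
  have "degree (\<Prod>m\<in>I - {k}. Polynomial.smult (1 / (y k - y m)) [:- y m, 1:]) \<le> card I - 1" if "k \<in> I" for k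
  proof -
    have "degree (\<Prod>m\<in>I - {k}. Polynomial.smult (1 / (y k - y m)) [:- y m, 1:])
        \<le> (\<Sum>m\<in>I - {k}. degree (Polynomial.smult (1 / (y k - y m)) [:- y m, 1:]))"
      using degree_prod_sum_le[of "I - {k}"] assms(1) unfolding o_def by blast
    also have "\<dots> \<le> (\<Sum>m\<in>I - {k}. 1)"
      by (intro sum_mono) auto
    finally show ?thesis
      using that assms(1) by simp
  qed
  then have "degree q \<le> card I - 1"
    unfolding q_def using assms(1) by (intro degree_sum_le) (auto intro: le_trans[OF degree_smult_le])
  then have deg_q: "degree q < card I"
    using assms(3) by linarith
  have agree: "poly q (y i) = poly p (y i)" if "i \<in> I" for i
  proof -
    have "(\<Prod>m\<in>I - {k}. (y i - y m) / (y k - y m)) = (if k = i then 1 else 0)" if "k \<in> I" for k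
    proof (cases "k = i")
      case True
      have "(\<Prod>m\<in>I - {i}. (y i - y m) / (y i - y m)) = (\<Prod>m\<in>I - {i}. 1)"
        using inj_onD[OF assms(2) _ \<open>i \<in> I\<close>] by (intro prod.cong) auto
      then show ?thesis using True by simp
    next
      case False
      then show ?thesis using \<open>i \<in> I\<close> assms(1) by (auto intro!: prod_zero)
    qed
    then have "poly q (y i) = (\<Sum>k\<in>I. if k = i then poly p (y k) else 0)"
      unfolding poly_q by (intro sum.cong) auto
    then show ?thesis using that assms(1) by simp
  qed
  have card: "card (y ` I) = card I"
    using assms(2) by (rule card_image)
  have "q = p"
  proof (rule poly_eqI_degree)
    show "poly q t = poly p t" if "t \<in> y ` I" for t
      using that agree by blast
  qed (simp_all only: card deg_q assms(3))
  then show ?thesis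
    using poly_q by blast
qed

text \<open>Let \<open>p\<close> be the Lagrange basis polynomial of the node \<open>x j\<close>
  among the \<open>x m\<close>. Up to the factor \<open>?P j / ?P i\<close>, which does not depend
  on \<open>k\<close>, the sum interpolates \<open>p\<close> at the nodes \<open>y k\<close> and
  evaluates the result at \<open>x i\<close>. It therefore equals \<open>poly p (x i)\<close>, which
  is 1 or 0.\<close>

lemma cauchy_inverse:
  fixes x y :: "'i \<Rightarrow> 'a :: field"
  assumes "finite I" "inj_on x I" "inj_on y I"
    and xy: "\<And>k i. k \<in> I \<Longrightarrow> i \<in> I \<Longrightarrow> y k \<noteq> x i"
    and "i \<in> I" "j \<in> I"
  shows "(\<Sum>k\<in>I. 1 / (y k - x i) *
      ((y k - x j) * (\<Prod>m\<in>I - {j}. (y k - x m) / (x j - x m))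
        * (\<Prod>m\<in>I - {k}. (y m - x j) / (y m - y k)))) = (if i = j then 1 else 0)"
proof -
  define p where "p = (\<Prod>m\<in>I - {j}. Polynomial.smult (1 / (x j - x m)) [:- x m, 1:])"
  have poly_p: "poly p t = (\<Prod>m\<in>I - {j}. (t - x m) / (x j - x m))" for t
    by (simp add: p_def poly_prod diff_divide_distrib)
  have "degree p \<le> (\<Sum>m\<in>I - {j}. degree (Polynomial.smult (1 / (x j - x m)) [:- x m, 1:]))"
    unfolding p_def using degree_prod_sum_le[of "I - {j}"] assms(1) unfolding o_def by blast
  also have "\<dots> \<le> (\<Sum>m\<in>I - {j}. 1)"
    by (intro sum_mono) auto
  also have "\<dots> < card I"
    using card_Diff1_less[OF assms(1) \<open>j \<in> I\<close>] by simp
  finally have deg: "degree p < card I" .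
  have split: "(\<Prod>m\<in>I. y m - x l) = (y k - x l) * (\<Prod>m\<in>I - {k}. y m - x l)" if "k \<in> I" for k l
    using assms(1) that by (rule prod.remove)
  have flip: "(\<Prod>m\<in>I - {k}. (y m - x l) / (y m - y k)) = (\<Prod>m\<in>I - {k}. (x l - y m) / (y k - y m))" for k l
    by (intro prod.cong) (auto simp: minus_divide_divide[symmetric, of "y _ - x l"])
  let ?P = "\<lambda>l. \<Prod>m\<in>I. y m - x l"
  have P0: "?P l \<noteq> 0" if "l \<in> I" for l
    using xy that assms(1) by auto
  have term_eq: "1 / (y k - x i) * ((y k - x j) * (\<Prod>m\<in>I - {j}. (y k - x m) / (x j - x m))
        * (\<Prod>m\<in>I - {k}. (y m - x j) / (y m - y k)))
      = ?P j / ?P i * (poly p (y k) * (\<Prod>m\<in>I - {k}. (x i - y m) / (y k - y m)))" (is "?L = ?R")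
    if k: "k \<in> I" for k
  proof -
    have "(\<Prod>m\<in>I - {k}. y m - x i) \<noteq> 0"
      using P0[OF \<open>i \<in> I\<close>] split[OF k, of i] by auto
    \<comment> \<open>Here \<open>a * r\<close> and \<open>c * r'\<close> stand for
      \<open>?P i\<close> and \<open>?P j\<close> with the factor at \<open>k\<close> split off;
      \<open>q\<close> is the product of the \<open>y m - y k\<close>.\<close>
    moreover have "1 / a * (c * p * (r' / q)) = c * r' / (a * r) * (p * (r / q))"
      if "r \<noteq> 0" for a c p q r r' :: 'a
      using that by simp
    ultimately show ?thesis
      unfolding flip[symmetric] poly_p split[OF k] unfolding prod_dividef by blast
  qed
  have "(\<Sum>k\<in>I. 1 / (y k - x i) *
      ((y k - x j) * (\<Prod>m\<in>I - {j}. (y k - x m) / (x j - x m))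
        * (\<Prod>m\<in>I - {k}. (y m - x j) / (y m - y k)))) = ?P j / ?P i * poly p (x i)"
    unfolding lagrange_interpolation[OF assms(1,3) deg, of "x i"] sum_distrib_left
    by (intro sum.cong refl term_eq)
  also have "poly p (x i) = (if i = j then 1 else 0)"
  proof (cases "i = j")
    case True
    have "poly p (x j) = (\<Prod>m\<in>I - {j}. 1)"
      unfolding poly_p using inj_onD[OF assms(2) _ \<open>j \<in> I\<close>] by (intro prod.cong) auto
    then show ?thesis using True by simp
  next
    case False
    then show ?thesis unfolding poly_p using \<open>i \<in> I\<close> assms(1) by (auto intro!: prod_zero)
  qed
  finally show ?thesis
    using P0[OF \<open>i \<in> I\<close>] by auto
qed

text \<open>This allows the node differences to be replaced by versions with denominators cleared.
  The weights of the two products cancel; what remains is \<open>w (X j) / w (X i)\<close>, which is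
  1 on the diagonal and multiplies 0 elsewhere.\<close>

lemma weighted_cauchy_inverse:
  fixes z w :: "'b \<Rightarrow> 'a :: field" and X Y :: "'i \<Rightarrow> 'b"
  defines "d \<equiv> \<lambda>u v. w u * w v * (z u - z v)"
  assumes "finite I"
    and wX: "\<And>i. i \<in> I \<Longrightarrow> w (X i) \<noteq> 0" and wY: "\<And>i. i \<in> I \<Longrightarrow> w (Y i) \<noteq> 0"
    and "inj_on (z \<circ> X) I" "inj_on (z \<circ> Y) I"
    and "\<And>k i. k \<in> I \<Longrightarrow> i \<in> I \<Longrightarrow> z (Y k) \<noteq> z (X i)"
    and "i \<in> I" "j \<in> I"
  shows "(\<Sum>k\<in>I. 1 / d (Y k) (X i) *
      (d (Y k) (X j) * (\<Prod>m\<in>I - {j}. d (Y k) (X m) / d (X j) (X m))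
        * (\<Prod>m\<in>I - {k}. d (Y m) (X j) / d (Y m) (Y k)))) = (if i = j then 1 else 0)"
    (is "(\<Sum>k\<in>I. ?T k) = _")
proof -
  let ?U = "\<lambda>k. 1 / (z (Y k) - z (X i)) *
      ((z (Y k) - z (X j)) * (\<Prod>m\<in>I - {j}. (z (Y k) - z (X m)) / (z (X j) - z (X m)))
        * (\<Prod>m\<in>I - {k}. (z (Y m) - z (X j)) / (z (Y m) - z (Y k))))"
  have "?T k = w (X j) / w (X i) * ?U k" if k: "k \<in> I" for k
  proof -
    have "(\<Prod>m\<in>I - {j}. d (Y k) (X m) / d (X j) (X m))
        = (\<Prod>m\<in>I - {j}. w (Y k) / w (X j) * ((z (Y k) - z (X m)) / (z (X j) - z (X m))))"
      using wX by (intro prod.cong) (auto simp: d_def)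
    then have 1: "(\<Prod>m\<in>I - {j}. d (Y k) (X m) / d (X j) (X m))
        = (w (Y k) / w (X j)) ^ (card I - 1) * (\<Prod>m\<in>I - {j}. (z (Y k) - z (X m)) / (z (X j) - z (X m)))"
      using assms(2) \<open>j \<in> I\<close> by (simp only: prod.distrib prod_constant card_Diff_singleton)
    have "(\<Prod>m\<in>I - {k}. d (Y m) (X j) / d (Y m) (Y k))
        = (\<Prod>m\<in>I - {k}. w (X j) / w (Y k) * ((z (Y m) - z (X j)) / (z (Y m) - z (Y k))))"
      using wY by (intro prod.cong) (auto simp: d_def)
    then have 2: "(\<Prod>m\<in>I - {k}. d (Y m) (X j) / d (Y m) (Y k))
        = (w (X j) / w (Y k)) ^ (card I - 1) * (\<Prod>m\<in>I - {k}. (z (Y m) - z (X j)) / (z (Y m) - z (Y k)))"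
      using k assms(2) by (simp only: prod.distrib prod_constant card_Diff_singleton)
    \<comment> \<open>Both products have \<open>card I - 1\<close> factors, and their weight ratios
      are reciprocal.\<close>
    have 3: "(w (Y k) / w (X j)) ^ (card I - 1) * (w (X j) / w (Y k)) ^ (card I - 1) = 1"
      unfolding power_mult_distrib[symmetric] using wX[OF \<open>j \<in> I\<close>] wY[OF k] by simp
    have 4: "1 / d (Y k) (X i) * d (Y k) (X j)
        = w (X j) / w (X i) * (1 / (z (Y k) - z (X i)) * (z (Y k) - z (X j)))"
      using wY[OF k] by (simp add: d_def)
    have "?T k = (1 / d (Y k) (X i) * d (Y k) (X j))
        * ((w (Y k) / w (X j)) ^ (card I - 1) * (w (X j) / w (Y k)) ^ (card I - 1))
        * (\<Prod>m\<in>I - {j}. (z (Y k) - z (X m)) / (z (X j) - z (X m)))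
        * (\<Prod>m\<in>I - {k}. (z (Y m) - z (X j)) / (z (Y m) - z (Y k)))"
      unfolding 1 2 by (simp only: mult_ac)
    then show ?thesis
      unfolding 3 4 by (simp only: mult_ac mult_1_right mult_1_left)
  qed
  then have "(\<Sum>k\<in>I. ?T k) = w (X j) / w (X i) * (\<Sum>k\<in>I. ?U k)"
    unfolding sum_distrib_left by (intro sum.cong refl)
  also have "(\<Sum>k\<in>I. ?U k) = (if i = j then 1 else 0)"
    using cauchy_inverse[of I "z \<circ> X" "z \<circ> Y" i j] assms by simp
  finally show ?thesis
    using wX[OF \<open>i \<in> I\<close>] by auto
qed

section \<open>Identities for Fibonacci polynomials and the distinctness of the nodes\<close>

lemma fib_rat_rec: "fib_rat (Suc (Suc k)) = to_fract [:0, 1:] * fib_rat (Suc k) + fib_rat k"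
  by (simp add: fib_rat_def to_fract_def)

lemma fib_rat_simps [simp]: "fib_rat 0 = 0" "fib_rat (Suc 0) = 1"
  by (simp_all add: fib_rat_def)

text \<open>At 1 the polynomials take the values of the Fibonacci numbers, which are positive from
  index 1 on. The induction carries two consecutive values because the recurrence has order
  two.\<close>

lemma fib_rat_nonzero [simp]: "fib_rat k = 0 \<longleftrightarrow> k = 0"
proof -
  have "poly (fib_poly j) 1 \<ge> 0 \<and> poly (fib_poly (Suc j)) 1 > 0" for j
    by (induction j) auto
  then have "fib_poly (Suc j) \<noteq> 0" for j
    by (metis less_irrefl poly_0)
  then show ?thesis
    by (cases k) (simp_all add: fib_rat_def)
qed

lemma fib_rat_add: "fib_rat (Suc (a + b)) = fib_rat (Suc a) * fib_rat (Suc b) + fib_rat a * fib_rat b"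
proof (induction b arbitrary: a)
  case (Suc b)
  show ?case
    using Suc[of "Suc a"] by (simp add: fib_rat_rec algebra_simps)
qed simp

text \<open>The left side is a 2 by 2 determinant of consecutive values. Raising \<open>b\<close> by
  one applies the recurrence, whose matrix has determinant -1.\<close>

lemma fib_rat_docagne:
  "fib_rat (b + c) * fib_rat (Suc b) - fib_rat (Suc (b + c)) * fib_rat b = (- 1) ^ b * fib_rat c"
  by (induction b) (auto simp: fib_rat_rec algebra_simps)


text \<open>
  The difference of the nodes \<open>a\<close> and \<open>b\<close> with denominators cleared.
\<close>

definition fib_wedge :: "nat \<Rightarrow> nat \<Rightarrow> rat poly fract" where
  "fib_wedge a b = fib_rat a * fib_rat (Suc b) - fib_rat (Suc a) * fib_rat b"

lemma fib_wedge_eq: "b \<le> a \<Longrightarrow> fib_wedge a b = (- 1) ^ b * fib_rat (a - b)"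
  using fib_rat_docagne[of b "a - b"] by (simp add: fib_wedge_def)

lemma fib_wedge_swap: "fib_wedge a b = - fib_wedge b a"
  by (simp add: fib_wedge_def)

lemma fib_wedge_node_diff:
  "fib_wedge a b = fib_rat (Suc a) * fib_rat (Suc b)
    * (fib_rat a / fib_rat (Suc a) - fib_rat b / fib_rat (Suc b))"
  by (simp add: fib_wedge_def field_simps)

text \<open>For distinct indices the wedge is, up to sign, some \<open>fib_rat k\<close> with
  \<open>k > 0\<close>.\<close>

lemma inj_fib_ratio: "inj (\<lambda>a. fib_rat a / fib_rat (Suc a))"
proof (rule linorder_injI)
  fix a b :: nat assume "a < b"
  then have "fib_wedge b a \<noteq> 0"
    by (simp add: fib_wedge_eq)
  then show "fib_rat a / fib_rat (Suc a) \<noteq> fib_rat b / fib_rat (Suc b)"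
    by (auto simp: fib_wedge_node_diff)
qed

section \<open>Fibonomial coefficients: recurrences and symmetry\<close>

lemma fibonomial_0 [simp]: "fibonomial a 0 = 1"
  by (simp add: fibonomial_def)

lemma fibonomial_Suc: "fibonomial a (Suc b) = fibonomial a b * (fib_rat (a - b) / fib_rat (Suc b))"
  by (simp add: fibonomial_def)

lemma fibonomial_Suc_Suc:
  "fibonomial (Suc a) (Suc b) = fibonomial a b * (fib_rat (Suc a) / fib_rat (Suc b))"
proof (induction b)
  case (Suc b)
  then show ?case
    by (simp add: fibonomial_Suc[of "Suc a" "Suc b"] fibonomial_Suc[of a b])
qed (simp add: fibonomial_Suc)

lemma fibonomial_eq_0: "a < b \<Longrightarrow> fibonomial a b = 0"
  by (induction b) (auto simp: fibonomial_Suc less_Suc_eq)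

lemma fibonomial_self [simp]: "fibonomial a a = 1"
  by (induction a) (auto simp: fibonomial_Suc_Suc)

text \<open>Multiply the addition formula for \<open>fib_rat (Suc a)\<close> by
  \<open>fibonomial a b / fib_rat (Suc b)\<close>. Both coefficients are polynomials, so integrality
  passes from row to row. At \<open>b = a\<close> the second one would have to be the value 1 at
  index -1, while truncated subtraction gives \<open>fib_rat 0 = 0\<close>.\<close>

lemma fibonomial_pascal:
  assumes "b < a"
  shows "fibonomial (Suc a) (Suc b)
    = fib_rat (Suc (Suc b)) * fibonomial a (Suc b) + fib_rat (a - Suc b) * fibonomial a b"
proof -
  obtain c where a: "a = Suc (b + c)"
    using assms less_iff_Suc_add by auto
  have "fib_rat (Suc a) = fib_rat (Suc (Suc b)) * fib_rat (a - b) + fib_rat (Suc b) * fib_rat (a - Suc b)"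
    using fib_rat_add[of "Suc b" c] by (simp add: a)
  then show ?thesis
    by (simp add: fibonomial_Suc_Suc fibonomial_Suc[of a b] field_simps)
qed

text \<open>Absorption lowers \<open>a\<close> by one, the induction hypothesis reflects the smaller
  coefficient, and absorption in the other argument restores the row.\<close>

lemma fibonomial_symmetric: "fibonomial (a + b) a = fibonomial (a + b) b"
proof (induction "a + b" arbitrary: a b)
  case 0
  then show ?case by simp
next
  case (Suc n)
  show ?case
  proof (cases "a = 0 \<or> b = 0")
    case False
    then obtain a' b' where ab: "a = Suc a'" "b = Suc b'"
      by (metis not0_implies_Suc)
    have n: "n = a' + Suc b'" "n = Suc a' + b'"
      using Suc(2) ab by auto
    have "fibonomial (a + b) a = fibonomial (a' + Suc b') a' * (fib_rat (a + b) / fib_rat a)"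
      by (simp add: ab fibonomial_Suc_Suc)
    also have "fibonomial (a' + Suc b') a' = fibonomial (a' + Suc b') (Suc b')"
      using n by (intro Suc(1))
    also have "\<dots> = fibonomial (a' + Suc b') b' * (fib_rat a / fib_rat b)"
      by (simp add: ab fibonomial_Suc[of _ b'])
    also have "\<dots> * (fib_rat (a + b) / fib_rat a) = fibonomial (a' + Suc b') b' * (fib_rat (a + b) / fib_rat b)"
      by (simp add: ab)
    also have "\<dots> = fibonomial (a + b) b"
      by (simp add: ab fibonomial_Suc_Suc)
    finally show ?thesis .
  qed auto
qed

section \<open>Integrality\<close>

text \<open>The copy of the integer polynomials inside the rational functions, as a set, so that
  integrality follows from closure under ring operations.\<close>

definition int_polys :: "rat poly fract set" where
  "int_polys = range (\<lambda>p :: int poly. to_fract (map_poly rat_of_int p))"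

lemma to_fract_of_int_poly [simp]:
  "to_fract (map_poly rat_of_int p) \<in> int_polys"
  by (simp add: int_polys_def)

lemma int_polys_add: "p \<in> int_polys \<Longrightarrow> q \<in> int_polys \<Longrightarrow> p + q \<in> int_polys"
proof -
  have "map_poly rat_of_int (a + b) = map_poly rat_of_int a + map_poly rat_of_int b" for a b
    by (simp add: poly_eq_iff coeff_map_poly)
  then show "p \<in> int_polys \<Longrightarrow> q \<in> int_polys \<Longrightarrow> p + q \<in> int_polys"
    unfolding int_polys_def by (metis (no_types, lifting) image_iff rangeI to_fract_add)
qed

lemma int_polys_mult: "p \<in> int_polys \<Longrightarrow> q \<in> int_polys \<Longrightarrow> p * q \<in> int_polys"
proof -
  have "map_poly rat_of_int (a * b) = map_poly rat_of_int a * map_poly rat_of_int b" for a b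
    by (simp add: poly_eq_iff coeff_map_poly coeff_mult)
  then show "p \<in> int_polys \<Longrightarrow> q \<in> int_polys \<Longrightarrow> p * q \<in> int_polys"
    unfolding int_polys_def by (metis (no_types, lifting) image_iff rangeI to_fract_mult)
qed

lemma int_polys_0: "0 \<in> int_polys" and int_polys_1: "1 \<in> int_polys"
  using to_fract_of_int_poly[of 0] to_fract_of_int_poly[of 1] by simp_all

lemma int_polys_minus_1: "- 1 \<in> int_polys"
  using to_fract_of_int_poly[of "[:- 1:]"] by (simp add: map_poly_pCons to_fract_def one_pCons flip: to_fract_1 to_fract_uminus)

lemma int_polys_power: "p \<in> int_polys \<Longrightarrow> p ^ k \<in> int_polys"
  by (induction k) (auto intro: int_polys_mult int_polys_1)

lemma int_polys_fib_rat: "fib_rat k \<in> int_polys"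
proof (induction k rule: fib_poly.induct)
  case (3 k)
  then show ?case
    using to_fract_of_int_poly[of "[:0, 1:]"]
    by (auto simp: fib_rat_rec map_poly_pCons intro!: int_polys_add int_polys_mult)
qed (simp_all add: int_polys_0 int_polys_1)

lemma int_polys_fibonomial: "fibonomial a b \<in> int_polys"
proof (induction a arbitrary: b)
  case 0
  then show ?case
    by (cases "b = 0") (auto simp: fibonomial_eq_0 int_polys_0 int_polys_1)
next
  case (Suc a)
  \<comment> \<open>The Pascal recurrence covers only the interior of the row; both ends and the
    vanishing range are separate.\<close>
  consider "b = 0" | "b = Suc a" | "b > Suc a" | c where "b = Suc c" "c < a"
    by (cases b) (auto, linarith)
  then show ?case
    by cases (auto simp: fibonomial_eq_0 fibonomial_pascal
        intro!: Suc int_polys_0 int_polys_1 int_polys_add int_polys_mult int_polys_fib_rat)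
qed

lemma int_polys_V_entry: "V_entry n i j \<in> int_polys"
  unfolding V_entry_def
  by (intro int_polys_mult int_polys_power int_polys_minus_1 int_polys_fib_rat int_polys_fibonomial)

section \<open>Closed form of the entries of the inverse\<close>

text \<open>The right side is the weighted Cauchy inverse for the nodes \<open>n - Suc j\<close> and
  \<open>n + k\<close>, with column \<open>j\<close> rescaled by a sign. Splitting each product at
  its omitted index gives four runs of Fibonacci ratios, each a Fibonomial coefficient up to sign;
  the remaining work is the parity of the total sign.\<close>

lemma V_entry_eq_cauchy_inverse:
  assumes "k < n" "j < n"
  shows "V_entry n (k + 1) (j + 1) = (- 1) ^ (n - Suc j) * (fib_wedge (n + k) (n - Suc j)
     * (\<Prod>m\<in>{..<n} - {j}. fib_wedge (n + k) (n - Suc m) / fib_wedge (n - Suc j) (n - Suc m))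
     * (\<Prod>m\<in>{..<n} - {k}. fib_wedge (n + m) (n - Suc j) / fib_wedge (n + m) (n + k)))"
proof -
  have wedge_YX: "fib_wedge (n + l) (n - Suc m) = (- 1) ^ (n - Suc m) * fib_rat (l + m + 1)"
    if "m < n" for l m
    using that by (subst fib_wedge_eq) auto
  have range_split: "{..<n} - {l} = {..<l} \<union> {Suc l..<n}" "{..<l} \<inter> {Suc l..<n} = {}"
    if "l < n" for l
    using that by auto
  have prod_split: "(\<Prod>m\<in>{..<n} - {l}. g m) = (\<Prod>m<l. g m) * (\<Prod>m=Suc l..<n. g m)"
    if "l < n" for l and g :: "nat \<Rightarrow> rat poly fract"
    unfolding range_split(1)[OF that] using range_split(2)[OF that] by (intro prod.union_disjoint) auto
  \<comment> \<open>The numerators have indices \<open>l' + l + 2\<close> to \<open>l' + n\<close>,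
    the denominators 1 to \<open>n - Suc l\<close>.\<close>
  have up: "(\<Prod>m=Suc l..<n. fib_rat (l' + m + 1) / fib_rat (m - l)) = fibonomial (n + l') (n - Suc l)"
    if "l < n" for l l'
    using less_imp_Suc_add[OF that]
  proof (elim exE)
    fix c assume "n = Suc (l + c)"
    moreover have "(\<Prod>m=Suc l..<Suc (l + c). fib_rat (l' + m + 1) / fib_rat (m - l))
        = fibonomial (Suc (l + c) + l') c"
      by (induction c) (auto simp: fibonomial_Suc_Suc Suc_diff_le add_ac)
    ultimately show ?thesis by simp
  qed
  \<comment> \<open>Numerators ascend from \<open>l' + 1\<close> while denominators descend to 1.
    Removing \<open>m = 0\<close> raises \<open>l'\<close> by one, so \<open>l'\<close> must vary in
    the induction.\<close>
  have down: "(\<Prod>m<l. fib_rat (l' + m + 1) / fib_rat (l - m)) = fibonomial (l + l') l" for l l'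
  proof (induction l arbitrary: l')
    case (Suc l)
    have "(\<Prod>m<Suc l. fib_rat (l' + m + 1) / fib_rat (Suc l - m))
        = fib_rat (Suc l') / fib_rat (Suc l) * fibonomial (l + Suc l') l"
      unfolding prod.lessThan_Suc_shift Suc[of "Suc l'", symmetric] by simp
    then show ?case
      by (simp add: fibonomial_Suc mult.commute)
  qed simp
  \<comment> \<open>For \<open>m > j\<close> both wedges carry the sign
    \<open>(- 1) ^ (n - Suc m)\<close>, which cancels.\<close>
  have X_up: "(\<Prod>m=Suc j..<n. fib_wedge (n + k) (n - Suc m) / fib_wedge (n - Suc j) (n - Suc m))
      = (\<Prod>m=Suc j..<n. fib_rat (k + m + 1) / fib_rat (m - j))"
    by (intro prod.cong) (auto simp: wedge_YX fib_wedge_eq)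
  \<comment> \<open>For \<open>m < j\<close> the denominator has its smaller index first; swapping
    it leaves the sign \<open>(- 1) ^ (j - m + 1)\<close>.\<close>
  have X_down: "(\<Prod>m<j. fib_wedge (n + k) (n - Suc m) / fib_wedge (n - Suc j) (n - Suc m))
      = (\<Prod>m<j. (- 1) ^ (j - m + 1) * (fib_rat (k + m + 1) / fib_rat (j - m)))"
  proof (intro prod.cong refl)
    fix m assume "m \<in> {..<j}"
    then have m: "m < j"
      by simp
    then have "n - Suc m = (n - Suc j) + (j - m)"
      using \<open>j < n\<close> by simp
    then have "(- 1) ^ (n - Suc m) = ((- 1) ^ (n - Suc j) * (- 1) ^ (j - m) :: rat poly fract)"
      by (simp only: power_add)
    then have "fib_wedge (n + k) (n - Suc m) = (- 1) ^ (n - Suc j) * (- 1) ^ (j - m) * fib_rat (k + m + 1)"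
      using m \<open>j < n\<close> by (simp add: wedge_YX)
    moreover have "fib_wedge (n - Suc j) (n - Suc m) = - ((- 1) ^ (n - Suc j) * fib_rat (j - m))"
      using m \<open>j < n\<close> by (subst fib_wedge_swap, subst fib_wedge_eq) auto
    ultimately show "fib_wedge (n + k) (n - Suc m) / fib_wedge (n - Suc j) (n - Suc m)
        = (- 1) ^ (j - m + 1) * (fib_rat (k + m + 1) / fib_rat (j - m))"
      using m by (simp add: field_simps)
  qed
  have "(- 1) ^ (n - Suc m) = ((- 1) ^ n * (- 1) ^ (m + 1) :: rat poly fract)" if "m < n" for m
    using that by (simp add: minus_one_power_iff)
  then have YX: "fib_wedge (n + m) (n - Suc j) = (- 1) ^ n * (- 1) ^ (j + 1) * fib_rat (j + m + 1)" for m
    using \<open>j < n\<close> by (simp add: wedge_YX add.commute[of j])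
  have ratio: "((- 1) ^ n * a * p) / ((- 1) ^ n * b * q) = a * b * (p / q)"
    if "b * b = 1" for a b p q :: "rat poly fract"
    using inverse_unique[OF that] by (simp add: divide_inverse)
  \<comment> \<open>The sign is the same for all \<open>m > k\<close>, so it comes out as a power;
    for \<open>m < k\<close> the swapped denominator makes it depend on \<open>m\<close>.\<close>
  have Y_up: "(\<Prod>m=Suc k..<n. fib_wedge (n + m) (n - Suc j) / fib_wedge (n + m) (n + k))
      = (\<Prod>m=Suc k..<n. (- 1) ^ (j + k + 1) * (fib_rat (j + m + 1) / fib_rat (m - k)))"
  proof (intro prod.cong refl)
    fix m assume "m \<in> {Suc k..<n}"
    then have YY: "fib_wedge (n + m) (n + k) = (- 1) ^ n * (- 1) ^ k * fib_rat (m - k)"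
      by (simp add: fib_wedge_eq power_add)
    show "fib_wedge (n + m) (n - Suc j) / fib_wedge (n + m) (n + k)
        = (- 1) ^ (j + k + 1) * (fib_rat (j + m + 1) / fib_rat (m - k))"
      unfolding YX YY by (subst ratio) (simp_all add: power_add)
  qed
  have Y_down: "(\<Prod>m<k. fib_wedge (n + m) (n - Suc j) / fib_wedge (n + m) (n + k))
      = (\<Prod>m<k. (- 1) ^ (j + m) * (fib_rat (j + m + 1) / fib_rat (k - m)))"
  proof (intro prod.cong refl)
    fix m assume "m \<in> {..<k}"
    then have YY: "fib_wedge (n + m) (n + k) = (- 1) ^ n * (- 1) ^ (m + 1) * fib_rat (k - m)"
      by (subst fib_wedge_swap) (simp add: fib_wedge_eq power_add)
    show "fib_wedge (n + m) (n - Suc j) / fib_wedge (n + m) (n + k)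
        = (- 1) ^ (j + m) * (fib_rat (j + m + 1) / fib_rat (k - m))"
      unfolding YX YY by (subst ratio) (simp_all add: power_add)
  qed
  \<comment> \<open>All signs of the two products; the sign of the leading wedge is cancelled
    separately in \<open>corner\<close>.\<close>
  define E where "E = (\<Prod>m<j. (- 1) ^ (j - m + 1)) * ((\<Prod>m<k. (- 1) ^ (j + m)) * ((- 1) ^ (j + k + 1)) ^ (n - Suc k) :: rat poly fract)"
  have X_sign: "(\<Prod>m<l. (- 1) ^ (l - m + 1)) = ((- 1) ^ ((Suc l choose 2) + l) :: rat poly fract)" for l
    by (induction l) (simp_all add: prod.lessThan_Suc_shift numeral_2_eq_2 power_add del: prod.lessThan_Suc)
  have Y_sign: "(\<Prod>m<l. (- 1) ^ (j + m)) = ((- 1) ^ (j * l + (l choose 2)) :: rat poly fract)" for l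
    by (induction l) (simp_all add: numeral_2_eq_2 power_add)
  have E: "E = (- 1) ^ (((Suc j choose 2) + j) + (j * k + (k choose 2)) + (j + k + 1) * (n - Suc k))"
    unfolding E_def X_sign Y_sign by (simp only: power_add power_mult mult.assoc)
  \<comment> \<open>Writing \<open>n\<close> this way removes the truncated
    \<open>n - Suc k\<close>, so that the parity claim becomes propositional.\<close>
  obtain c where c: "n = Suc (k + c)"
    using less_imp_Suc_add[OF \<open>k < n\<close>] by auto
  have choose: "(Suc l choose 2) = l + (l choose 2)" for l
    by (simp add: numeral_2_eq_2)
  have "even (((Suc j choose 2) + j) + (j * k + (k choose 2)) + (j + k + 1) * (n - Suc k))
      \<longleftrightarrow> even (sign_exp n (k + 1) (j + 1))"
    by (simp add: sign_exp_def choose c) argo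
  then have sign: "E = (- 1) ^ sign_exp n (k + 1) (j + 1)"
    unfolding E by (simp only: minus_one_power_iff)
  have corner: "(- 1) ^ (n - Suc j) * fib_wedge (n + k) (n - Suc j) = fib_rat (k + j + 1)"
    using \<open>j < n\<close> by (simp add: wedge_YX flip: power_add)
  have X: "(\<Prod>m\<in>{..<n} - {j}. fib_wedge (n + k) (n - Suc m) / fib_wedge (n - Suc j) (n - Suc m))
      = (\<Prod>m<j. (- 1) ^ (j - m + 1)) * fibonomial (j + k) j * fibonomial (n + k) (n - Suc j)"
    unfolding prod_split[OF \<open>j < n\<close>] X_up X_down up[OF \<open>j < n\<close>]
    by (simp only: prod.distrib down)
  have Y: "(\<Prod>m\<in>{..<n} - {k}. fib_wedge (n + m) (n - Suc j) / fib_wedge (n + m) (n + k))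
      = (\<Prod>m<k. (- 1) ^ (j + m)) * fibonomial (k + j) k
        * (((- 1) ^ (j + k + 1)) ^ (n - Suc k) * fibonomial (n + j) (n - Suc k))"
    unfolding prod_split[OF \<open>k < n\<close>] Y_up Y_down
    by (simp only: prod.distrib down up[OF \<open>k < n\<close>] prod_constant card_atLeastLessThan)
  have "(- 1) ^ (n - Suc j) * (fib_wedge (n + k) (n - Suc j)
     * (\<Prod>m\<in>{..<n} - {j}. fib_wedge (n + k) (n - Suc m) / fib_wedge (n - Suc j) (n - Suc m))
     * (\<Prod>m\<in>{..<n} - {k}. fib_wedge (n + m) (n - Suc j) / fib_wedge (n + m) (n + k)))
     = E * fib_rat (k + j + 1) * fibonomial (n + k) (n - Suc j) * fibonomial (n + j) (n - Suc k)
       * (fibonomial (j + k) j * fibonomial (k + j) k)"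
    unfolding X Y E_def mult.assoc[symmetric] corner by (simp only: mult_ac)
  \<comment> \<open>The two lower runs give reflected coefficients; symmetry merges them into the
    square in \<open>V_entry\<close>.\<close>
  also have "fibonomial (j + k) j = fibonomial (k + j) k"
    using fibonomial_symmetric[of j k] by (simp only: add.commute)
  also have "E * fib_rat (k + j + 1) * fibonomial (n + k) (n - Suc j) * fibonomial (n + j) (n - Suc k)
      * (fibonomial (k + j) k * fibonomial (k + j) k) = V_entry n (k + 1) (j + 1)"
    by (simp add: V_entry_def sign power2_eq_square)
  finally show ?thesis
    by (rule sym)
qed

section \<open>The matrix product\<close>

text \<open>Rewriting \<open>1 / fib_rat (i + k + 1)\<close> through the wedge costs a sign
  depending only on \<open>i\<close>, and the entry of \<open>V_mat\<close> brings one depending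
  only on \<open>j\<close>. Both leave the sum over \<open>k\<close>, which is then a weighted
  Cauchy sum.\<close>

lemma recip_hankel_mult_V:
  "recip_hankel_mat n fib_rat * V_mat n = 1\<^sub>m n"
proof (rule eq_matI)
  fix i j assume "i < dim_row (1\<^sub>m n :: rat poly fract mat)" "j < dim_col (1\<^sub>m n :: rat poly fract mat)"
  then have i: "i < n" and j: "j < n"
    by simp_all
  let ?d = "\<lambda>k j. fib_wedge (n + k) (n - Suc j)"
  let ?W = "\<lambda>k. ?d k j * (\<Prod>m\<in>{..<n} - {j}. ?d k m / fib_wedge (n - Suc j) (n - Suc m))
        * (\<Prod>m\<in>{..<n} - {k}. ?d m j / fib_wedge (n + m) (n + k))"
  have "(recip_hankel_mat n fib_rat * V_mat n) $$ (i, j)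
      = (\<Sum>k<n. 1 / fib_rat (i + k + 1) * V_entry n (k + 1) (j + 1))"
    using i j by (simp add: recip_hankel_mat_def V_mat_def scalar_prod_def atLeast0LessThan)
  also have "\<dots> = (\<Sum>k<n. (- 1) ^ (n - Suc i) * (- 1) ^ (n - Suc j) * (1 / ?d k i * ?W k))"
  proof (rule sum.cong[OF refl])
    fix k assume "k \<in> {..<n}"
    then have k: "k < n" by simp
    have "?d k i = (- 1) ^ (n - Suc i) * fib_rat (i + k + 1)"
      using i by (subst fib_wedge_eq) (auto simp: add.commute)
    then have "1 / fib_rat (i + k + 1) = (- 1) ^ (n - Suc i) * (1 / ?d k i)"
      by simp
    then show "1 / fib_rat (i + k + 1) * V_entry n (k + 1) (j + 1)
        = (- 1) ^ (n - Suc i) * (- 1) ^ (n - Suc j) * (1 / ?d k i * ?W k)"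
      unfolding V_entry_eq_cauchy_inverse[OF k j] by (simp only: mult_ac)
  qed
  also have "\<dots> = (- 1) ^ (n - Suc i) * (- 1) ^ (n - Suc j) * (\<Sum>k<n. 1 / ?d k i * ?W k)"
    by (simp only: sum_distrib_left)
  also have "(\<Sum>k<n. 1 / ?d k i * ?W k) = (if i = j then 1 else 0)"
    unfolding fib_wedge_node_diff
    using i j
    \<comment> \<open>The indices \<open>n - Suc i\<close> fill 0 to \<open>n - 1\<close> and the
      indices \<open>n + k\<close> fill \<open>n\<close> to \<open>2 * n - 1\<close>, so injectivity
      of the ratios gives all distinctness conditions.\<close>
    by (intro weighted_cauchy_inverse[where X = "\<lambda>i. n - Suc i" and Y = "\<lambda>k. n + k"
          and w = "\<lambda>a. fib_rat (Suc a)" and z = "\<lambda>a. fib_rat a / fib_rat (Suc a)"])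
      (auto intro!: comp_inj_on inj_on_subset[OF inj_fib_ratio] simp: inj_on_def dest!: injD[OF inj_fib_ratio])
  \<comment> \<open>On the diagonal the two signs coincide and their product is 1.\<close>
  also have "(- 1) ^ (n - Suc i) * (- 1) ^ (n - Suc j) * (if i = j then 1 else 0)
      = (1\<^sub>m n $$ (i, j) :: rat poly fract)"
    using i j by (simp flip: power_add)
  finally show "(recip_hankel_mat n fib_rat * V_mat n) $$ (i, j) = 1\<^sub>m n $$ (i, j)" .
qed (simp_all add: recip_hankel_mat_def V_mat_def)

theorem theorem2p2:
  fixes n :: nat
  assumes "n \<ge> 1"
  shows "inverts_mat (recip_hankel_mat n fib_rat) (V_mat n) \<and>
         inverts_mat (V_mat n) (recip_hankel_mat n fib_rat) \<and>
         (\<forall>i<n. \<forall>j<n. \<exists>p :: int poly.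
            V_mat n $$ (i, j) = to_fract (map_poly rat_of_int p))"
proof (intro conjI allI impI)
  have carrier: "recip_hankel_mat n fib_rat \<in> carrier_mat n n" "V_mat n \<in> carrier_mat n n"
    by (simp_all add: recip_hankel_mat_def V_mat_def)
  show "inverts_mat (recip_hankel_mat n fib_rat) (V_mat n)"
    using recip_hankel_mult_V carrier by (auto simp: inverts_mat_def)
  show "inverts_mat (V_mat n) (recip_hankel_mat n fib_rat)"
    using mat_mult_left_right_inverse[OF carrier recip_hankel_mult_V] carrier
    by (auto simp: inverts_mat_def)
  fix i j assume "i < n" "j < n"
  then have "V_mat n $$ (i, j) \<in> int_polys"
    by (simp add: V_mat_def int_polys_V_entry)
  then show "\<exists>p :: int poly. V_mat n $$ (i, j) = to_fract (map_poly rat_of_int p)"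
    by (auto simp: int_polys_def)
qed

end
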